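(* Let $a,b,p,q$ be positive real numbers and let $x\in(0,1)$. Then $$\Phi_{p,q}(a,b;x)\,\Phi_{p,q+2}(a,b;x) - \Phi_{p,q+1}(a,b;x)^2 \ge 0$$ and $$\Phi_{p,q}(a,b;x)\,\Phi_{p+2,q}(a,b;x) - \Phi_{p+1,q}(a,b;x)^2 \ge 0.$$
   Context: The generalized polylogarithm is $$\Phi_{p,q}(a,b;x) = \sum_{k=1}^\infty \frac{(1+a)^p(1+b)^q}{(k+a)^p(k+b)^q} x^k, \qquad |x|<1.$$ *)

theory Defs
  imports "HOL-Analysis.Analysis"
begin

text \<open>
  The summation index is shifted: the \<open>n\<close>-th term here, \<open>n \<ge> 0\<close>, is the term \<open>k = n + 1\<close> of
  the series over \<open>k \<ge> 1\<close>. The bases of the real powers are positive for \<open>a, b > -1\<close>; the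
  series then converges for \<open>\<bar>x\<bar> < 1\<close>.
\<close>

definition gen_polylog :: "real \<Rightarrow> real \<Rightarrow> real \<Rightarrow> real \<Rightarrow> real \<Rightarrow> real" where
  "gen_polylog p q a b x =
     (\<Sum>n. ((1 + a) powr p * (1 + b) powr q) /
           ((real (Suc n) + a) powr p * (real (Suc n) + b) powr q) * x ^ Suc n)"

end

theory Submission
  imports Defs
begin

text \<open>Raising \<open>q\<close> by one multiplies the k-th term of the series by r_k =
  (1+b)/(k+b), and raising it by two multiplies it by r_k^2. For x \<ge> 0 the terms of
  \<open>gen_polylog p q a b x\<close> are nonnegative weights, so the first inequality is
  Cauchy-Schwarz for the sequences 1 and r in the weighted l^2 space
  (\<open>gen_polylog_turan_ineq\<close>). The second follows from the symmetry exchanging (a,p)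
  with (b,q).\<close>

lemma Cauchy_Schwarz_suminf_weighted:
  fixes w r :: "nat \<Rightarrow> real"
  assumes "\<And>n. 0 \<le> w n" and "summable w"
    and "summable (\<lambda>n. w n * r n)" and "summable (\<lambda>n. w n * (r n)\<^sup>2)"
  shows "(\<Sum>n. w n * r n)\<^sup>2 \<le> (\<Sum>n. w n) * (\<Sum>n. w n * (r n)\<^sup>2)"
proof (rule LIMSEQ_le)
  show "(\<lambda>N. (\<Sum>n<N. w n * r n)\<^sup>2) \<longlonglongrightarrow> (\<Sum>n. w n * r n)\<^sup>2"
    by (intro tendsto_power summable_LIMSEQ assms)
  show "(\<lambda>N. (\<Sum>n<N. w n) * (\<Sum>n<N. w n * (r n)\<^sup>2)) \<longlonglongrightarrow> (\<Sum>n. w n) * (\<Sum>n. w n * (r n)\<^sup>2)"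
    by (intro tendsto_mult summable_LIMSEQ assms)
  have "(\<Sum>n<N. w n * r n)\<^sup>2 \<le> (\<Sum>n<N. w n) * (\<Sum>n<N. w n * (r n)\<^sup>2)" for N
    \<comment> \<open>Half of each weight goes to either factor, as \<open>sqrt (w n)\<close>; the
      bound for partial sums then passes to the limit.\<close>
    using Cauchy_Schwarz_ineq_sum[of "\<lambda>n. sqrt (w n)" "\<lambda>n. sqrt (w n) * r n" "{..<N}"] assms(1)
    by (simp add: power_mult_distrib flip: mult.assoc)
  then show "\<exists>N. \<forall>n\<ge>N. (\<Sum>i<n. w i * r i)\<^sup>2 \<le> (\<Sum>i<n. w i) * (\<Sum>i<n. w i * (r i)\<^sup>2)"
    by blast
qed

lemma gen_polylog_commute: "gen_polylog p q a b x = gen_polylog q p b a x"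
  by (simp add: gen_polylog_def mult.commute)

text \<open>Each coefficient lies in (0,1], because k + a \<ge> 1 + a > 0, likewise for
  \<open>b\<close>, and the exponents are nonnegative. A geometric series therefore
  dominates.\<close>

lemma summable_gen_polylog:
  fixes a b p q x :: real
  assumes "a > -1" and "b > -1" and "p \<ge> 0" and "q \<ge> 0" and "\<bar>x\<bar> < 1"
  shows "summable (\<lambda>n. ((1 + a) powr p * (1 + b) powr q) /
           ((real (Suc n) + a) powr p * (real (Suc n) + b) powr q) * x ^ Suc n)"
proof (rule summable_comparison_test')
  show "summable (\<lambda>n. \<bar>x\<bar> ^ Suc n)"
    using assms by (simp add: summable_mult)
  fix n :: nat
  let ?c = "((1 + a) powr p * (1 + b) powr q) /
           ((real (Suc n) + a) powr p * (real (Suc n) + b) powr q)"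
  have "(1 + a) powr p * (1 + b) powr q \<le> (real (Suc n) + a) powr p * (real (Suc n) + b) powr q"
    using assms by (intro mult_mono powr_mono2) auto
  moreover have "(real (Suc n) + a) powr p * (real (Suc n) + b) powr q > 0"
    using assms by simp
  ultimately have "\<bar>?c\<bar> \<le> 1"
    by simp
  then have "\<bar>?c\<bar> * \<bar>x\<bar> ^ Suc n \<le> 1 * \<bar>x\<bar> ^ Suc n"
    by (intro mult_right_mono) auto
  then show "norm (?c * x ^ Suc n) \<le> \<bar>x\<bar> ^ Suc n"
    by (simp only: real_norm_def abs_mult power_abs mult_1)
qed

lemma gen_polylog_turan_ineq:
  fixes a b p q x :: real
  assumes "a > -1" and "b > -1" and "p \<ge> 0" and "q \<ge> 0" and "0 \<le> x" and "x < 1"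
  shows "(gen_polylog p (q + 1) a b x)\<^sup>2 \<le> gen_polylog p q a b x * gen_polylog p (q + 2) a b x"
proof -
  define w where "w q n = ((1 + a) powr p * (1 + b) powr q) /
           ((real (Suc n) + a) powr p * (real (Suc n) + b) powr q) * x ^ Suc n" for q n
  define r where "r n = (1 + b) / (real (Suc n) + b)" for n
  \<comment> \<open>Since b > -1, the bases are positive, so the extra \<open>powr\<close> factors
    with exponents 1 and 2 are ordinary powers.\<close>
  have w1: "w (q + 1) = (\<lambda>n. w q n * r n)" and w2: "w (q + 2) = (\<lambda>n. w q n * (r n)\<^sup>2)"
    using assms by (auto simp: fun_eq_iff w_def r_def powr_add power_divide mult_ac)
  have sm: "summable (w (q + d))" if "d \<ge> 0" for d
    unfolding w_def using assms that by (intro summable_gen_polylog) auto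
  have "(\<Sum>n. w q n * r n)\<^sup>2 \<le> (\<Sum>n. w q n) * (\<Sum>n. w q n * (r n)\<^sup>2)"
    \<comment> \<open>The three series converge by \<open>sm\<close>; the last \<open>simp\<close>
      settles nonnegativity of the weights, which rests on x \<ge> 0.\<close>
    using sm[of 0] sm[of 1] sm[of 2] assms
    by (intro Cauchy_Schwarz_suminf_weighted) (simp_all flip: w1 w2, simp add: w_def)
  moreover have "gen_polylog p q a b x = (\<Sum>n. w q n)" for q
    by (simp only: gen_polylog_def w_def)
  ultimately show ?thesis
    by (simp only: w1 w2)
qed

theorem theorem3p2:
  fixes a b p q x :: real
  assumes "a > 0" and "b > 0" and "p > 0" and "q > 0" and "x \<in> {0<..<1}"
  shows "gen_polylog p q a b x * gen_polylog p (q + 2) a b x - (gen_polylog p (q + 1) a b x)\<^sup>2 \<ge> 0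
    \<and> gen_polylog p q a b x * gen_polylog (p + 2) q a b x - (gen_polylog (p + 1) q a b x)\<^sup>2 \<ge> 0"
  \<comment> \<open>The second instance has the roles swapped; fixing \<open>b a\<close> on the left
    of \<open>gen_polylog_commute\<close> orients the rewriting back to \<open>a b\<close>.\<close>
  using assms gen_polylog_turan_ineq[of a b p q x] gen_polylog_turan_ineq[of b a q p x]
  by (simp add: gen_polylog_commute[of _ p b a] gen_polylog_commute[of q _ b a])

end
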